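(* (i) Every orthogonal pseudo-orthomodular poset is orthomodular. (ii) Every orthogonal modular poset with complementation is orthomodular.
   Context: For a poset $(P,\leq)$ and $A\subseteq P$ let $L(A)=\{x\in P\mid x\leq y\text{ for all }y\in A\}$ and $U(A)=\{x\in P\mid y\leq x\text{ for all }y\in A\}$; we write $L(a,b)$ for $L(\{a,b\})$, $L(A,a)$ for $L(A\cup\{a\})$, etc., and similarly for $U$. A poset is modular if for all $x,y,z$, $x\leq z$ implies $L(U(x,y),z)=L(U(x,L(y,z)))$. A poset with complementation is $(P,\leq,{}',0,1)$ with $(P,\leq,0,1)$ a bounded poset and $'$ a unary operation such that $L(x,x')=\{0\}$, $U(x,x')=\{1\}$, $x\leq y$ implies $y'\leq x'$, and $(x')'=x$. A pseudo-orthomodular poset is a poset with complementation satisfying $L(U(L(x,y),y'),y)=L(x,y)$ for all $x,y$. An orthogonal poset is a poset with complementation in which $x\leq y'$ implies that $x\vee y$ exists; consequently, if $x\leq y$ then $x\vee y'$ and $(x\vee y')\wedge y$ exist. An orthomodular poset is an orthogonal poset satisfying the orthomodular law: for all $x\leq y$, $(x\vee y')\wedge y=x$ (equivalently, $((x\wedge y)\vee y')\wedge y=x\wedge y$ and $((x\vee y)\wedge y')\vee y=x\vee y$ wherever these are formed in the orthogonal poset). *)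

theory Defs
  imports "HOL-Algebra.Lattice"
begin

text \<open>
  Posets are \<^locale>\<open>partial_order\<close> structures, so \<open>.=\<close> is equality. The operators
  \<open>L(A)\<close> and \<open>U(A)\<close> are \<^const>\<open>Lower\<close> and \<^const>\<open>Upper\<close>; all arguments passed to them
  below are subsets of the carrier. The parameter \<open>c\<close> is the complementation \<open>'\<close>, and
  \<open>0\<close>, \<open>1\<close> are \<open>\<bottom>\<close>, \<open>\<top>\<close>.
\<close>

locale modular_poset = partial_order L for L (structure) +
  assumes modular:
    "\<lbrakk>x \<in> carrier L; y \<in> carrier L; z \<in> carrier L; x \<sqsubseteq> z\<rbrakk> \<Longrightarrow>
      Lower L (Upper L {x, y} \<union> {z}) = Lower L (Upper L ({x} \<union> Lower L {y, z}))"

locale bounded_poset =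
  partial_order L + weak_partial_order_bottom L + weak_partial_order_top L
  for L (structure)

locale complementation_poset = bounded_poset L
  for L (structure) and c :: "'a \<Rightarrow> 'a" +
  assumes c_closed [simp, intro]: "x \<in> carrier L \<Longrightarrow> c x \<in> carrier L"
    and Lower_c: "x \<in> carrier L \<Longrightarrow> Lower L {x, c x} = {\<bottom>}"
    and Upper_c: "x \<in> carrier L \<Longrightarrow> Upper L {x, c x} = {\<top>}"
    and c_antitone: "\<lbrakk>x \<in> carrier L; y \<in> carrier L; x \<sqsubseteq> y\<rbrakk> \<Longrightarrow> c y \<sqsubseteq> c x"
    and c_involution [simp]: "x \<in> carrier L \<Longrightarrow> c (c x) = x"

locale pseudo_orthomodular_poset = complementation_poset +
  assumes pseudo_orthomodular:
    "\<lbrakk>x \<in> carrier L; y \<in> carrier L\<rbrakk> \<Longrightarrow>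
      Lower L (Upper L (Lower L {x, y} \<union> {c y}) \<union> {y}) = Lower L {x, y}"

locale orthogonal_poset = complementation_poset +
  assumes orthogonal_join_exists:
    "\<lbrakk>x \<in> carrier L; y \<in> carrier L; x \<sqsubseteq> c y\<rbrakk> \<Longrightarrow> \<exists>s. is_lub L s {x, y}"

text \<open>
  \<^const>\<open>join\<close> and \<^const>\<open>meet\<close> are total functions with arbitrary values where no
  supremum or infimum exists. The next two lemmas show that both operations in the orthomodular
  law are always genuine.
\<close>

lemma (in orthogonal_poset) is_lub_join_c:
  assumes x: "x \<in> carrier L" and y: "y \<in> carrier L" and le: "x \<sqsubseteq> y"
  shows "is_lub L (x \<squnion> c y) {x, c y}"
proof -
  have "\<exists>s. is_lub L s {x, c y}"
    using orthogonal_join_exists [of x "c y"] x y le by simp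
  then show ?thesis
    unfolding join_def sup_def by (rule someI_ex)
qed

lemma (in orthogonal_poset) is_glb_meet_join_c:
  assumes x: "x \<in> carrier L" and y: "y \<in> carrier L" and le: "x \<sqsubseteq> y"
  shows "is_glb L ((x \<squnion> c y) \<sqinter> y) {x \<squnion> c y, y}"
proof -
  define s where "s = x \<squnion> c y"
  have lub: "is_lub L s {x, c y}"
    unfolding s_def by (rule is_lub_join_c [OF assms])
  then have s: "s \<in> carrier L" by simp
  have "c y \<sqsubseteq> s"
    using least_Upper_above [OF lub, of "c y"] x y by simp
  then have "c s \<sqsubseteq> c (c y)"
    using c_antitone y s by blast
  then obtain t where t: "is_lub L t {c s, c y}"
    using orthogonal_join_exists [of "c s" "c y"] s y by auto
  then have tc: "t \<in> carrier L" by simp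
  have ts: "c s \<sqsubseteq> t" and ty: "c y \<sqsubseteq> t"
    using least_Upper_above [OF t] s y by simp_all
  have "is_glb L (c t) {s, y}"
  proof (rule greatest_LowerI)
    fix z assume "z \<in> {s, y}"
    then show "c t \<sqsubseteq> z"
      using c_antitone [OF _ tc ts] c_antitone [OF _ tc ty] s y by auto
  next
    fix z assume z: "z \<in> Lower L {s, y}"
    then have zc: "z \<in> carrier L" and "z \<sqsubseteq> s" "z \<sqsubseteq> y"
      using s y by (auto simp: Lower_def)
    then have "c z \<in> Upper L {c s, c y}"
      using c_antitone s y by (auto simp: Upper_def)
    then have "t \<sqsubseteq> c z" by (rule least_le [OF t])
    then show "z \<sqsubseteq> c t"
      using c_antitone [OF tc, of "c z"] zc by simp
  qed (use s y tc in auto)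
  then have "\<exists>m. is_glb L m {s, y}" ..
  then show ?thesis
    unfolding meet_def inf_def s_def by (rule someI_ex)
qed

locale orthomodular_poset = orthogonal_poset +
  assumes orthomodular:
    "\<lbrakk>x \<in> carrier L; y \<in> carrier L; x \<sqsubseteq> y\<rbrakk> \<Longrightarrow> (x \<squnion> c y) \<sqinter> y = x"

end

theory Submission
  imports Defs
begin

text \<open>
  For \<open>x \<le> y\<close> the element \<open>(x \<or> y') \<and> y\<close> lies in \<open>L(U(x, y'), y)\<close>, and it is always above \<open>x\<close>.
  So the orthomodular law says that every element of this cone is below \<open>x\<close>. The pseudo-orthomodular
  law gives this because \<open>x \<in> L(x, y)\<close>, and modularity gives it because \<open>L(y', y) = {0}\<close>.
\<close>

lemma (in orthogonal_poset) meet_join_c_in_cone: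
  assumes x: "x \<in> carrier L" and y: "y \<in> carrier L" and le: "x \<sqsubseteq> y"
  shows "(x \<squnion> c y) \<sqinter> y \<in> Lower L (Upper L {x, c y} \<union> {y})"
proof -
  note lub = is_lub_join_c [OF assms] and glb = is_glb_meet_join_c [OF assms]
  define s m where "s = x \<squnion> c y" and "m = (x \<squnion> c y) \<sqinter> y"
  have s: "s \<in> carrier L" and m: "m \<in> carrier L"
    using lub glb unfolding s_def m_def by simp_all
  have ms: "m \<sqsubseteq> s" and my: "m \<sqsubseteq> y"
    using greatest_Lower_below [OF glb] s y unfolding s_def m_def by simp_all
  \<comment> \<open>\<open>s\<close> is the least element of \<open>Upper L {x, c y}\<close>, so a
    bound by \<open>s\<close> passes to every \<open>u\<close> in that set.\<close>
  have "m \<sqsubseteq> u" if u: "u \<in> Upper L {x, c y}" for u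
  proof -
    have "s \<sqsubseteq> u" using least_le [OF lub u] unfolding s_def .
    then show ?thesis using le_trans ms m s u by (auto simp: Upper_def)
  qed
  then show ?thesis
    using m my unfolding m_def [symmetric] by (auto simp: Lower_def)
qed

text \<open>Common reduction for both parts: \<open>cone\<close> mentions neither join nor meet, so
  laws about \<open>Lower\<close> and \<open>Upper\<close> apply to it directly. The other
  inequality is free, as \<open>x\<close> is a lower bound of \<open>x \<squnion> c y\<close> and
  \<open>y\<close>.\<close>

lemma (in orthogonal_poset) orthomodular_posetI:
  assumes cone: "\<And>x y m. \<lbrakk>x \<in> carrier L; y \<in> carrier L; x \<sqsubseteq> y;
    m \<in> Lower L (Upper L {x, c y} \<union> {y})\<rbrakk> \<Longrightarrow> m \<sqsubseteq> x"
  shows "orthomodular_poset L c"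
proof
  fix x y assume x: "x \<in> carrier L" and y: "y \<in> carrier L" and le: "x \<sqsubseteq> y"
  note lub = is_lub_join_c [OF x y le] and glb = is_glb_meet_join_c [OF x y le]
  have "x \<sqsubseteq> x \<squnion> c y"
    using least_Upper_above [OF lub, of x] x y by simp
  then have "x \<in> Lower L {x \<squnion> c y, y}"
    using x le by (auto simp: Lower_def)
  then have "x \<sqsubseteq> (x \<squnion> c y) \<sqinter> y"
    by (rule greatest_le [OF glb])
  moreover have "(x \<squnion> c y) \<sqinter> y \<sqsubseteq> x"
    using cone [OF x y le meet_join_c_in_cone [OF x y le]] .
  ultimately show "(x \<squnion> c y) \<sqinter> y = x"
    using le_antisym x glb by simp
qed

lemma orthogonal_pseudo_orthomodular_imp_orthomodular:
  assumes "orthogonal_poset P c" and "pseudo_orthomodular_poset P c"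
  shows "orthomodular_poset P c"
proof -
  interpret orthogonal_poset P c by fact
  interpret pseudo_orthomodular_poset P c by fact
  show ?thesis
  proof (rule orthomodular_posetI)
    fix x y m
    assume x: "x \<in> carrier P" and y: "y \<in> carrier P" and le: "x \<sqsubseteq>\<^bsub>P\<^esub> y"
      and m: "m \<in> Lower P (Upper P {x, c y} \<union> {y})"
    have "x \<in> Lower P {x, y}"
      using x le by (auto simp: Lower_def)
    \<comment> \<open>Enlarging \<open>{x}\<close> to \<open>Lower P {x, y}\<close> shrinks the set
      of upper bounds and so enlarges the cone, up to the one in the pseudo-orthomodular
      law.\<close>
    then have "Upper P (Lower P {x, y} \<union> {c y}) \<subseteq> Upper P {x, c y}"
      by (intro Upper_antimono) auto
    then have "Lower P (Upper P {x, c y} \<union> {y}) \<subseteq> Lower P (Upper P (Lower P {x, y} \<union> {c y}) \<union> {y})"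
      by (intro Lower_antimono) auto
    then have "m \<in> Lower P {x, y}"
      using m pseudo_orthomodular [OF x y] by auto
    then show "m \<sqsubseteq>\<^bsub>P\<^esub> x"
      using x by (auto simp: Lower_def)
  qed
qed

lemma orthogonal_modular_imp_orthomodular:
  assumes "orthogonal_poset P c" and "modular_poset P"
  shows "orthomodular_poset P c"
proof -
  interpret orthogonal_poset P c by fact
  interpret modular_poset P by fact
  show ?thesis
  proof (rule orthomodular_posetI)
    fix x y m
    assume x: "x \<in> carrier P" and y: "y \<in> carrier P" and le: "x \<sqsubseteq>\<^bsub>P\<^esub> y"
      and m: "m \<in> Lower P (Upper P {x, c y} \<union> {y})"
    have "Lower P {c y, y} = {\<bottom>\<^bsub>P\<^esub>}"
      using Lower_c [OF y] by (simp add: insert_commute)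
    \<comment> \<open>Modularity is used with \<open>c y\<close> as its middle element and
      \<open>y\<close> as the upper one, so its inner cone is
      \<open>Lower P {c y, y}\<close>.\<close>
    then have "m \<in> Lower P (Upper P {x, \<bottom>\<^bsub>P\<^esub>})"
      using m modular [OF x c_closed [OF y] y le] by (simp add: insert_commute)
    \<comment> \<open>\<open>x\<close> is itself one of the upper bounds that \<open>m\<close> lies
      below.\<close>
    moreover have "x \<in> Upper P {x, \<bottom>\<^bsub>P\<^esub>}"
      using x bottom_lower by (auto simp: Upper_def)
    ultimately show "m \<sqsubseteq>\<^bsub>P\<^esub> x"
      using x by (auto simp: Lower_def)
  qed
qed

theorem theorem3:
  fixes P :: "('a, 'b) gorder_scheme" and c :: "'a \<Rightarrow> 'a"
  shows "(orthogonal_poset P c \<and> pseudo_orthomodular_poset P c \<longrightarrow> orthomodular_poset P c) \<and>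
         (orthogonal_poset P c \<and> modular_poset P \<longrightarrow> orthomodular_poset P c)"
  using orthogonal_pseudo_orthomodular_imp_orthomodular orthogonal_modular_imp_orthomodular
  by blast

end
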